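(* (a) Let $M$ be a metric space that is quasi-isometric to a geodesic metric space and is not quasi-isometric to a point, a ray or a line. Then $\operatorname{Br}(M)\ge 3$. (b) Let $M$ be a uniformly discrete metric space that is quasi-isometric to a geodesic metric space. Then $\operatorname{Br}(M)=2$ if and only if $M$ is either bounded or quasi-isometric to a ray or to a line.
   Context: All orders are total orders. Let $(M,d)$ be a (non-empty) metric space. For a finite subset $X\subset M$, $l_{\mathrm{opt}}(X)$ is the minimum of $\sum_{i=1}^{m-1} d(y_i,y_{i+1})$ over all enumerations $y_1,\dots,y_m$ of $X$. If $T$ is an order on $M$ and $x_1<_T\dots<_T x_m$ are the points of $X$, put $l_T(X)=\sum_{i=1}^{m-1} d(x_i,x_{i+1})$. If $M$ has at least two points, then for $k\ge 1$ $$\operatorname{OR}_{M,T}(k)=\sup_{X\subset M,\ 2\le \#X\le k+1}\frac{l_T(X)}{l_{\mathrm{opt}}(X)};$$ if $M$ is a single point, $\operatorname{OR}_{M,T}(k)=1$ for all $k\ge1$. The order breakpoint $\operatorname{Br}(M,T)$ is the smallest integer $s\ge 1$ such that $\operatorname{OR}_{M,T}(s)<s$ ($\infty$ if no such $s$ exists), and $\operatorname{Br}(M)=\min_T \operatorname{Br}(M,T)$ over all orders $T$ on $M$. A metric space is uniformly discrete if there is $\delta>0$ such that any two distinct points are at distance at least $\delta$. A map $\alpha:N\to M$ is a quasi-isometric embedding if there are $C_1\ge1$, $C_2\ge0$ with $\frac1{C_1}d_N(x_1,x_2)-C_2\le d_M(\alpha(x_1),\alpha(x_2))\le C_1d_N(x_1,x_2)+C_2$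 for all $x_1,x_2\in N$; it is a quasi-isometry if moreover $M$ is at bounded distance from $\alpha(N)$. *)

theory Defs
  imports "HOL-Analysis.Analysis" "HOL-Combinatorics.Multiset_Permutations"
begin

text \<open>
  Metric spaces are elements of the library type \<^typ>\<open>'a metric\<close>, i.e. a carrier
  \<^const>\<open>mspace\<close> with a distance \<^const>\<open>mdist\<close> on it. The carrier may be empty there;
  non-emptiness is assumed where it is needed. A total order on \<open>M\<close> is a (reflexive) relation \<open>T\<close>
  with \<open>linear_order_on (mspace M) T\<close>.
\<close>

definition list_length :: "'a metric \<Rightarrow> 'a list \<Rightarrow> real" where
  "list_length M xs = (\<Sum>i<length xs - 1. mdist M (xs ! i) (xs ! Suc i))"

definition opt_length :: "'a metric \<Rightarrow> 'a set \<Rightarrow> real" where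
  "opt_length M X = Min (list_length M ` permutations_of_set X)"

definition enum_of :: "'a rel \<Rightarrow> 'a set \<Rightarrow> 'a list" where
  "enum_of T X = (THE xs. xs \<in> permutations_of_set X \<and> sorted_wrt (\<lambda>x y. (x, y) \<in> T) xs)"

lemma ex1_enum_of:
  assumes T: "linear_order_on A T" and X: "finite X" "X \<subseteq> A"
  shows "\<exists>!xs. xs \<in> permutations_of_set X \<and> sorted_wrt (\<lambda>x y. (x, y) \<in> T) xs"
proof -
  from T have tr: "trans T" and an: "antisym T"
    and tot: "\<And>x y. x \<in> A \<Longrightarrow> y \<in> A \<Longrightarrow> (x, y) \<in> T \<or> (y, x) \<in> T"
    by (simp_all add: order_on_defs refl_on_def total_on_def) metis
  have ex: "\<exists>xs. set xs = X \<and> distinct xs \<and> sorted_wrt (\<lambda>x y. (x, y) \<in> T) xs"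
    using X
  proof (induction X rule: finite_induct)
    case (insert x F)
    then obtain xs where xs: "set xs = F" "distinct xs" "sorted_wrt (\<lambda>x y. (x, y) \<in> T) xs"
      by auto
    let ?zs = "filter (\<lambda>y. (y, x) \<in> T) xs @ x # filter (\<lambda>y. (y, x) \<notin> T) xs"
    have "(x, y) \<in> T" if "y \<in> F" "(y, x) \<notin> T" for y
      using tot[of x y] that insert.prems by auto
    then have "sorted_wrt (\<lambda>x y. (x, y) \<in> T) ?zs"
      using xs transD[OF tr] by (auto simp: sorted_wrt_append sorted_wrt_filter)
    moreover have "set ?zs = insert x F" "distinct ?zs"
      using xs insert.hyps by auto
    ultimately show ?case by blast
  qed auto
  have un: "xs = ys"
    if "set xs = set ys" "distinct xs" "distinct ys"
      "sorted_wrt (\<lambda>x y. (x, y) \<in> T) xs" "sorted_wrt (\<lambda>x y. (x, y) \<in> T) ys"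
    for xs ys
    using that
  proof (induction xs arbitrary: ys)
    case (Cons x xs)
    then obtain y zs where ys: "ys = y # zs"
      by (cases ys) auto
    have "x = y"
    proof (rule ccontr)
      assume "x \<noteq> y"
      then have "y \<in> set xs" "x \<in> set zs"
        using Cons.prems(1) ys by auto
      then show False
        using Cons.prems ys \<open>x \<noteq> y\<close> antisymD[OF an] by auto
    qed
    with Cons.prems ys have "set xs = set zs"
      by auto
    with Cons ys \<open>x = y\<close> show ?case
      by auto
  qed auto
  show ?thesis
    using ex un by (fastforce simp: permutations_of_set_def)
qed

definition order_length :: "'a metric \<Rightarrow> 'a rel \<Rightarrow> 'a set \<Rightarrow> real" where
  "order_length M T X = list_length M (enum_of T X)"

text \<open>
  Both functions below are meant for \<open>k \<ge> 1\<close> and non-empty \<open>M\<close>. The values are extended reals only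
  so that the supremum makes sense without a boundedness proof.
\<close>

definition order_ratio :: "'a metric \<Rightarrow> 'a rel \<Rightarrow> nat \<Rightarrow> ereal" where
  "order_ratio M T k =
     (if \<exists>x. mspace M = {x} then 1
      else SUP X \<in> {X. X \<subseteq> mspace M \<and> 2 \<le> card X \<and> card X \<le> k + 1}.
             ereal (order_length M T X / opt_length M X))"

text \<open>In \<^typ>\<open>enat\<close>, the infimum of the empty set is \<open>\<infinity>\<close>, and that of a non-empty set is its minimum.\<close>

definition order_breakpoint :: "'a metric \<Rightarrow> 'a rel \<Rightarrow> enat" where
  "order_breakpoint M T = Inf (enat ` {s. 1 \<le> s \<and> order_ratio M T s < ereal (real s)})"

definition breakpoint :: "'a metric \<Rightarrow> enat" where
  "breakpoint M = (INF T \<in> {T. linear_order_on (mspace M) T}. order_breakpoint M T)"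

definition uniformly_discrete :: "'a metric \<Rightarrow> bool" where
  "uniformly_discrete M \<longleftrightarrow>
     (\<exists>\<delta>>0. \<forall>x\<in>mspace M. \<forall>y\<in>mspace M. x \<noteq> y \<longrightarrow> \<delta> \<le> mdist M x y)"

definition bounded_space :: "'a metric \<Rightarrow> bool" where
  "bounded_space M \<longleftrightarrow> Metric_space.mbounded (mspace M) (mdist M) (mspace M)"

definition geodesic_space :: "'a metric \<Rightarrow> bool" where
  "geodesic_space M \<longleftrightarrow>
     (\<forall>x\<in>mspace M. \<forall>y\<in>mspace M. \<exists>\<gamma> :: real \<Rightarrow> 'a.
        \<gamma> \<in> {0..mdist M x y} \<rightarrow> mspace M \<and> \<gamma> 0 = x \<and> \<gamma> (mdist M x y) = y \<and>
        (\<forall>s\<in>{0..mdist M x y}. \<forall>t\<in>{0..mdist M x y}. mdist M (\<gamma> s) (\<gamma> t) = \<bar>s - t\<bar>))"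

definition quasi_isometric_embedding :: "'a metric \<Rightarrow> 'b metric \<Rightarrow> ('a \<Rightarrow> 'b) \<Rightarrow> bool" where
  "quasi_isometric_embedding N M \<alpha> \<longleftrightarrow>
     \<alpha> \<in> mspace N \<rightarrow> mspace M \<and>
     (\<exists>C1\<ge>1. \<exists>C2\<ge>0. \<forall>x\<in>mspace N. \<forall>y\<in>mspace N.
        1 / C1 * mdist N x y - C2 \<le> mdist M (\<alpha> x) (\<alpha> y) \<and>
        mdist M (\<alpha> x) (\<alpha> y) \<le> C1 * mdist N x y + C2)"

definition quasi_isometry :: "'a metric \<Rightarrow> 'b metric \<Rightarrow> ('a \<Rightarrow> 'b) \<Rightarrow> bool" where
  "quasi_isometry N M \<alpha> \<longleftrightarrow>
     quasi_isometric_embedding N M \<alpha> \<and>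
     (\<exists>D. \<forall>y\<in>mspace M. \<exists>x\<in>mspace N. mdist M y (\<alpha> x) \<le> D)"

definition quasi_isometric :: "'a metric \<Rightarrow> 'b metric \<Rightarrow> bool" where
  "quasi_isometric N M \<longleftrightarrow> (\<exists>\<alpha>. quasi_isometry N M \<alpha>)"

definition point_space :: "real metric" where
  "point_space = submetric euclidean_metric {0}"

definition ray_space :: "real metric" where
  "ray_space = submetric euclidean_metric {0..}"

definition line_space :: "real metric" where
  "line_space = euclidean_metric"

end

theory Submission
  imports Defs
begin

text \<open>
  The condition \<open>OR(2) < 2\<close> says that, up to a constant \<open>K\<close>, a point between \<open>x\<close> and \<open>z\<close> in the
  order is no farther from \<open>x\<close> and \<open>z\<close> than they are from each other. A chain with bounded steps
  from \<open>x\<close> to \<open>z\<close> must jump over every point between them in the order, hence passes near it. In a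
  coarsely geodesic space the distances therefore add up along the order up to a constant, and the
  signed distance to a base point is a quasi-isometric embedding into the line whose image is
  coarsely an interval. Conversely, the order of the line, pulled back along a quasi-isometric
  embedding with ties broken arbitrarily, has the above property when the space is uniformly
  discrete; for a bounded space a constant map serves as the embedding.
\<close>

section \<open>Orders that are thin on triples\<close>

definition thin_order :: "'a metric \<Rightarrow> 'a rel \<Rightarrow> real \<Rightarrow> bool" where
  "thin_order M T K \<longleftrightarrow>
     (\<forall>x\<in>mspace M. \<forall>y\<in>mspace M. \<forall>z\<in>mspace M. (x, y) \<in> T \<longrightarrow> (y, z) \<in> T \<longrightarrow>
        mdist M x y \<le> K * mdist M x z \<and> mdist M y z \<le> K * mdist M x z)"

lemma mdist_self [simp]: "x \<in> mspace M \<Longrightarrow> mdist M x x = 0"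
  by simp

lemma quasi_isometric_embeddingI:
  assumes "\<And>x. x \<in> mspace N \<Longrightarrow> f x \<in> mspace M" "1 \<le> A" "0 \<le> B"
    and "\<And>x y. x \<in> mspace N \<Longrightarrow> y \<in> mspace N \<Longrightarrow> 1 / A * mdist N x y - B \<le> mdist M (f x) (f y)"
    and "\<And>x y. x \<in> mspace N \<Longrightarrow> y \<in> mspace N \<Longrightarrow> mdist M (f x) (f y) \<le> A * mdist N x y + B"
  shows "quasi_isometric_embedding N M f"
  unfolding quasi_isometric_embedding_def using assms by blast

lemma list_length_pair [simp]: "list_length M [x, y] = mdist M x y"
  by (simp add: list_length_def)

lemma list_length_triple [simp]: "list_length M [x, y, z] = mdist M x y + mdist M y z"
  by (simp add: list_length_def numeral_2_eq_2)

lemma list_length_pos: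
  assumes "distinct xs" "set xs \<subseteq> mspace M" "2 \<le> length xs"
  shows "0 < list_length M xs"
proof -
  from assms(3) obtain x y zs where xs: "xs = x # y # zs"
    by (metis One_nat_def Suc_1 Suc_le_length_iff)
  have "0 < mdist M x y"
    using assms xs by (metis distinct_length_2_or_more insert_subset less_eq_real_def list.simps(15)
        mdist_nonneg mdist_zero)
  also have "\<dots> = mdist M (xs ! 0) (xs ! Suc 0)"
    using xs by simp
  also have "\<dots> \<le> list_length M xs"
    unfolding list_length_def
    by (rule member_le_sum[where f = "\<lambda>i. mdist M (xs ! i) (xs ! Suc i)"]) (auto simp: xs)
  finally show ?thesis .
qed

lemma opt_length_le:
  assumes "finite X" "xs \<in> permutations_of_set X"
  shows "opt_length M X \<le> list_length M xs"
  unfolding opt_length_def using assms by (intro Min_le) auto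

lemma opt_length_attained:
  assumes "finite X"
  obtains xs where "xs \<in> permutations_of_set X" "opt_length M X = list_length M xs"
proof -
  have "opt_length M X \<in> list_length M ` permutations_of_set X"
    unfolding opt_length_def using assms by (intro Min_in) auto
  then show ?thesis using that by auto
qed

text \<open>Keeps the denominators in \<open>order_ratio\<close> away from the default value of
  division by zero, so ratio bounds can be multiplied out.\<close>

lemma opt_length_pos:
  assumes "X \<subseteq> mspace M" "2 \<le> card X"
  shows "0 < opt_length M X"
proof -
  have fin: "finite X"
    using assms(2) by (metis card.infinite not_numeral_le_zero)
  then obtain xs where xs: "xs \<in> permutations_of_set X" "opt_length M X = list_length M xs"
    by (rule opt_length_attained)
  then show ?thesis
    using list_length_pos[of xs M] assms by (auto simp: permutations_of_set_def distinct_card)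
qed

lemma enum_of_eq:
  assumes "linear_order_on (mspace M) T" "finite X" "X \<subseteq> mspace M"
    and "xs \<in> permutations_of_set X" "sorted_wrt (\<lambda>x y. (x, y) \<in> T) xs"
  shows "enum_of T X = xs"
  unfolding enum_of_def using ex1_enum_of[OF assms(1-3)] assms(4,5) by (intro the1_equality) auto

lemma order_length_triple:
  assumes T: "linear_order_on (mspace M) T" and "{x, y, z} \<subseteq> mspace M" "distinct [x, y, z]"
    and "(x, y) \<in> T" "(y, z) \<in> T"
  shows "order_length M T {x, y, z} = mdist M x y + mdist M y z"
proof -
  have "(x, z) \<in> T"
    using T assms(4,5) by (auto simp: order_on_defs dest: transD)
  then have "enum_of T {x, y, z} = [x, y, z]"
    using assms by (intro enum_of_eq[OF T]) (auto simp: permutations_of_set_def)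
  then show ?thesis by (simp add: order_length_def)
qed

text \<open>Only sets of two or three points matter, and on two points the ratio is 1. For
  \<open>x\<close>, \<open>y\<close>, \<open>z\<close> in increasing order with sides
  \<open>a\<close>, \<open>b\<close> and outer side \<open>c\<close>, a path of length
  \<open>a + c\<close> satisfies \<open>a + b \<le> 2 * (a + c) - c\<close>, and thinness makes
  \<open>c\<close> a fixed fraction of \<open>a + c\<close>. A uniform gap is needed, since the
  supremum itself must stay below 2.\<close>

lemma thin_order_imp_order_ratio_less:
  assumes T: "linear_order_on (mspace M) T" and K: "0 \<le> K" and thin: "thin_order M T K"
  shows "order_ratio M T 2 < 2"
proof -
  \<comment> \<open>From \<open>a \<le> K * c\<close> follows
    \<open>c \<ge> (a + c) / (1 + K)\<close>; this fraction is what the factor 2 loses.\<close>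
  define r where "r = 2 - 1 / (1 + K)"
  have r: "1 \<le> r" "r < 2"
    using K by (auto simp: r_def field_simps)
  have "order_length M T X / opt_length M X \<le> r"
    if X: "X \<subseteq> mspace M" "2 \<le> card X" "card X \<le> 2 + 1" for X
  proof -
    have fin: "finite X"
      using X(2) by (metis card.infinite not_numeral_le_zero)
    obtain xs where xs: "xs \<in> permutations_of_set X" "sorted_wrt (\<lambda>x y. (x, y) \<in> T) xs"
      using ex1_enum_of[OF T fin X(1)] by blast
    have ol: "order_length M T X = list_length M xs"
      using enum_of_eq[OF T fin X(1) xs] by (simp add: order_length_def)
    obtain ys where ys: "ys \<in> permutations_of_set X" "opt_length M X = list_length M ys"
      using opt_length_attained[OF fin] by blast
    note pos = opt_length_pos[OF X(1,2)]
    have set_xs: "set xs = X" "distinct xs" and set_ys: "set ys = X" "distinct ys"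
      using xs(1) ys(1) by (auto simp: permutations_of_set_def)
    have len: "length xs = card X" "length ys = card X"
      using set_xs set_ys distinct_card by metis+
    consider "card X = 2" | "card X = 3" using X by linarith
    then have "order_length M T X \<le> r * opt_length M X"
    proof cases
      case 1
      then obtain x y where xy: "xs = [x, y]"
        using len by (auto simp: length_Suc_conv numeral_2_eq_2)
      obtain u v where uv: "ys = [u, v]"
        using len 1 by (auto simp: length_Suc_conv numeral_2_eq_2)
      have "list_length M xs = opt_length M X"
        using set_xs set_ys ys(2) xy uv by (auto simp: doubleton_eq_iff mdist_commute)
      then show ?thesis
        using ol r pos by simp
    next
      case 2
      then obtain x y z where xyz: "xs = [x, y, z]"
        using len by (auto simp: length_Suc_conv numeral_3_eq_3)
      obtain u v w where uvw: "ys = [u, v, w]"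
        using len 2 by (auto simp: length_Suc_conv numeral_3_eq_3)
      define a b c where "a = mdist M x y" and "b = mdist M y z" and "c = mdist M x z"
      have M: "x \<in> mspace M" "y \<in> mspace M" "z \<in> mspace M"
        using set_xs X xyz by auto
      have tri: "a \<le> b + c" "b \<le> a + c"
        using mdist_triangle[of x M z y] mdist_triangle[of y M x z] M
        by (simp_all add: a_def b_def c_def mdist_commute)
      have Kc: "a \<le> K * c" "b \<le> K * c"
        using thin xs(2) M xyz by (auto simp: thin_order_def a_def b_def c_def)
      \<comment> \<open>A path through three points omits exactly one side of the triangle.\<close>
      have "opt_length M X = a + b \<or> opt_length M X = a + c \<or> opt_length M X = b + c"
      proof -
        have "{u, v, w} = {x, y, z}" using set_xs set_ys xyz uvw by auto
        then have "u \<in> {x, y, z}" "v \<in> {x, y, z}" "w \<in> {x, y, z}" by auto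
        then show ?thesis
          using set_ys(2) ys(2) uvw by (auto simp: a_def b_def c_def mdist_commute)
      qed
      moreover have "p + q \<le> r * (p + c)" if "p \<le> K * c" "q \<le> p + c" for p q
      proof -
        define w where "w = (p + c) / (1 + K)"
        have "w \<le> c"
          using that K by (simp add: w_def field_simps)
        then have "p + q \<le> 2 * (p + c) - w"
          using that(2) by (simp add: algebra_simps)
        also have "\<dots> = r * (p + c)"
          by (simp add: r_def w_def left_diff_distrib)
        finally show ?thesis .
      qed
      from this[of a b] this[of b a] have "a + b \<le> r * (a + c)" "a + b \<le> r * (b + c)"
        using Kc tri by (simp_all add: add.commute)
      moreover have "1 * (a + b) \<le> r * (a + b)"
        using r by (intro mult_right_mono) (auto simp: a_def b_def)
      ultimately have "a + b \<le> r * opt_length M X" by auto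
      then show ?thesis
        using ol xyz by (simp add: a_def b_def)
    qed
    then show ?thesis
      using pos by (simp add: field_simps)
  qed
  \<comment> \<open>The bound \<open>1 \<le> r\<close> also covers the value that
    \<open>order_ratio\<close> assigns to a one-point space.\<close>
  then have "order_ratio M T 2 \<le> ereal r"
    unfolding order_ratio_def using r by (auto intro!: SUP_least simp: one_ereal_def)
  also have "\<dots> < 2" using r by simp
  finally show ?thesis .
qed

text \<open>The order path through \<open>x\<close>, \<open>y\<close>, \<open>z\<close> competes
  with the enumerations \<open>y, x, z\<close> and \<open>x, z, y\<close>. If the outer side were
  tiny compared with the other two, one of these would be almost half as long.\<close>

lemma order_ratio_less_imp_thin_order:
  assumes T: "linear_order_on (mspace M) T" and less: "order_ratio M T 2 < 2"
  obtains K where "1 \<le> K" "thin_order M T K"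
proof -
  \<comment> \<open>A real number strictly between the ratio and 2; the maximum with 1 makes it
    positive.\<close>
  obtain s where s: "max 1 (order_ratio M T 2) < ereal s" "s < 2"
    using ereal_dense2[of "max 1 (order_ratio M T 2)" 2] less by force
  \<comment> \<open>Inserting \<open>b \<ge> a - c\<close> into
    \<open>a + b \<le> s * (a + c)\<close> gives \<open>(2 - s) * a \<le> (1 + s) * c\<close>, and
    \<open>1 + s \<le> 3\<close>.\<close>
  define K where "K = 3 / (2 - s)"
  have K: "1 \<le> K" "0 < s" using s by (auto simp: K_def field_simps one_ereal_def)
  have "mdist M x y \<le> K * mdist M x z \<and> mdist M y z \<le> K * mdist M x z"
    if M: "x \<in> mspace M" "y \<in> mspace M" "z \<in> mspace M" and ord: "(x, y) \<in> T" "(y, z) \<in> T"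
    for x y z
  proof (cases "distinct [x, y, z]")
    case False
    have "x = y \<or> y = z"
      using False ord T by (auto simp: order_on_defs dest: antisymD)
    moreover have "mdist M x z \<le> K * mdist M x z" "0 \<le> K * mdist M x z"
      using K mult_right_mono[of 1 K "mdist M x z"] by auto
    ultimately show ?thesis
      using M by auto
  next
    case True
    let ?X = "{x, y, z}"
    define a b c where "a = mdist M x y" and "b = mdist M y z" and "c = mdist M x z"
    have X: "?X \<subseteq> mspace M" "card ?X = 3" using M True by auto
    then have "ereal (order_length M T ?X / opt_length M ?X) \<le> order_ratio M T 2"
      unfolding order_ratio_def using True by (auto intro!: SUP_upper)
    also have "\<dots> < ereal s" using s by simp
    finally have "order_length M T ?X / opt_length M ?X < s" by simp
    moreover have "0 < opt_length M ?X"
      using X by (intro opt_length_pos) auto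
    ultimately have *: "a + b \<le> s * opt_length M ?X"
      using order_length_triple[OF T X(1) True ord] by (simp add: a_def b_def field_simps)
    have "opt_length M ?X \<le> a + c" "opt_length M ?X \<le> b + c"
      using opt_length_le[of ?X "[y, x, z]" M] opt_length_le[of ?X "[x, z, y]" M] True
      by (auto simp: permutations_of_set_def a_def b_def c_def mdist_commute insert_commute)
    then have ab: "a + b \<le> s * (a + c)" "a + b \<le> s * (b + c)"
      using * K(2) by (meson mult_left_mono order_trans less_imp_le)+
    have tri: "a \<le> b + c" "b \<le> a + c" "0 \<le> c"
      using mdist_triangle[of x M z y] mdist_triangle[of y M x z] M
      by (simp_all add: a_def b_def c_def mdist_commute)
    have "s * c \<le> 2 * c"
      using s tri by (intro mult_right_mono) auto
    then have "(2 - s) * a \<le> 3 * c" "(2 - s) * b \<le> 3 * c"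
      using ab tri by (auto simp: algebra_simps)
    then have "a \<le> K * c" "b \<le> K * c"
      using s by (auto simp: K_def field_simps)
    then show ?thesis by (simp add: a_def b_def c_def)
  qed
  then show ?thesis
    using that K by (auto simp: thin_order_def)
qed

text \<open>Excludes 1 as a breakpoint, so below 3 only the ratio at 2 remains. The order path is
  one of the enumerations over which the optimum is taken.\<close>

lemma order_ratio_1_ge:
  assumes T: "linear_order_on (mspace M) T" and ne: "mspace M \<noteq> {}"
  shows "1 \<le> order_ratio M T 1"
proof (cases "\<exists>x. mspace M = {x}")
  case False
  then obtain x y where xy: "x \<in> mspace M" "y \<in> mspace M" "x \<noteq> y"
    using ne by blast
  let ?X = "{x, y}"
  obtain xs where xs: "xs \<in> permutations_of_set ?X" "sorted_wrt (\<lambda>x y. (x, y) \<in> T) xs"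
    using ex1_enum_of[OF T, of ?X] xy by auto
  have "enum_of T ?X = xs"
    using xy xs by (intro enum_of_eq[OF T]) auto
  then have "opt_length M ?X \<le> order_length M T ?X"
    using xs opt_length_le[of ?X xs M] by (simp add: order_length_def)
  moreover have "0 < opt_length M ?X"
    using xy by (intro opt_length_pos) auto
  ultimately have "1 \<le> ereal (order_length M T ?X / opt_length M ?X)"
    by (simp add: one_ereal_def)
  also have "\<dots> \<le> order_ratio M T 1"
    unfolding order_ratio_def using xy False by (auto intro!: SUP_upper)
  finally show ?thesis .
qed (auto simp: order_ratio_def)

section \<open>Breakpoints in terms of thin orders\<close>

lemma order_breakpoint_ge_2:
  assumes "linear_order_on (mspace M) T" "mspace M \<noteq> {}"
  shows "2 \<le> order_breakpoint M T"
  unfolding order_breakpoint_def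
proof (rule Inf_greatest, clarify)
  fix s assume s: "1 \<le> s" "order_ratio M T s < ereal (real s)"
  then have "s \<noteq> 1"
    using order_ratio_1_ge[OF assms] by (auto simp: one_ereal_def)
  with s show "2 \<le> enat s"
    by (simp add: numeral_eq_enat)
qed

lemma breakpoint_ge_2: "mspace M \<noteq> {} \<Longrightarrow> 2 \<le> breakpoint M"
  unfolding breakpoint_def by (auto intro!: INF_greatest order_breakpoint_ge_2)

lemma breakpoint_eq_2I:
  assumes "linear_order_on (mspace M) T" "mspace M \<noteq> {}" "0 \<le> K" "thin_order M T K"
  shows "breakpoint M = 2"
proof (rule antisym)
  have "breakpoint M \<le> order_breakpoint M T"
    unfolding breakpoint_def using assms by (auto intro: INF_lower)
  also have "\<dots> \<le> enat 2"
    unfolding order_breakpoint_def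
    using thin_order_imp_order_ratio_less[OF assms(1,3,4)] by (intro Inf_lower) auto
  finally show "breakpoint M \<le> 2" by (simp add: numeral_eq_enat)
qed (rule breakpoint_ge_2[OF assms(2)])

lemma breakpoint_less_3E:
  assumes "mspace M \<noteq> {}" "\<not> 3 \<le> breakpoint M"
  obtains T K where "linear_order_on (mspace M) T" "1 \<le> K" "thin_order M T K"
proof -
  from assms(2) obtain T where T: "linear_order_on (mspace M) T" "order_breakpoint M T < 3"
    unfolding breakpoint_def by (auto simp: not_le INF_less_iff)
  then obtain s where s: "1 \<le> s" "order_ratio M T s < ereal (real s)" "enat s < 3"
    unfolding order_breakpoint_def by (auto simp: Inf_less_iff)
  have "s \<noteq> 1"
    using order_ratio_1_ge[OF T(1) assms(1)] s by (auto simp: one_ereal_def)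
  with s have "s = 2" by (simp add: numeral_eq_enat)
  with s have "order_ratio M T 2 < 2" by simp
  then show ?thesis
    using order_ratio_less_imp_thin_order[OF T(1)] that T(1) by blast
qed

section \<open>Thin orders from coarse embeddings into the line\<close>

text \<open>Points are ordered by \<open>f\<close>, with an auxiliary well-order breaking ties
  because \<open>f\<close> need not be injective. For \<open>x\<close>, \<open>y\<close>,
  \<open>z\<close> in increasing order the values of \<open>f\<close> are monotone, so the embedding
  bounds the inner distances affinely by \<open>mdist M x z\<close>. Uniform discreteness turns the
  additive constant into a multiplicative one.\<close>

lemma uniformly_discrete_embedding_imp_breakpoint:
  assumes ne: "mspace M \<noteq> {}" and ud: "uniformly_discrete M"
    and qi: "quasi_isometric_embedding M line_space f"
  shows "breakpoint M = 2"
proof -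
  obtain W where W: "well_order_on (mspace M) W"
    using well_order_on by blast
  define T where "T = {(x, y). x \<in> mspace M \<and> y \<in> mspace M \<and>
    (f x < f y \<or> f x = f y \<and> (x, y) \<in> W)}"
  have W: "refl_on (mspace M) W" "trans W" "antisym W" "total_on (mspace M) W"
    using W by (auto simp: order_on_defs)
  have T: "linear_order_on (mspace M) T"
    unfolding order_on_defs
  proof (intro conjI)
    show "refl_on (mspace M) T" "T \<subseteq> mspace M \<times> mspace M"
      using W(1) by (auto simp: T_def refl_on_def)
    show "trans T"
      using transD[OF W(2)] by (force simp: T_def intro!: transI)
    show "antisym T"
      using antisymD[OF W(3)] by (force simp: T_def intro!: antisymI)
    show "total_on (mspace M) T"
      using W(4) by (force simp: T_def total_on_def)
  qed
  obtain \<delta> where \<delta>: "0 < \<delta>" "\<And>x y. x \<in> mspace M \<Longrightarrow> y \<in> mspace M \<Longrightarrow> x \<noteq> y \<Longrightarrow> \<delta> \<le> mdist M x y"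
    using ud by (auto simp: uniformly_discrete_def)
  obtain A B where AB: "1 \<le> A" "0 \<le> B"
    and low: "\<And>x y. x \<in> mspace M \<Longrightarrow> y \<in> mspace M \<Longrightarrow> 1 / A * mdist M x y - B \<le> \<bar>f x - f y\<bar>"
    and up: "\<And>x y. x \<in> mspace M \<Longrightarrow> y \<in> mspace M \<Longrightarrow> \<bar>f x - f y\<bar> \<le> A * mdist M x y + B"
    using qi by (auto simp: quasi_isometric_embedding_def line_space_def dist_real_def)
  \<comment> \<open>The affine bound is \<open>A * (A * d + 2 * B)\<close> with
    \<open>d = mdist M x z\<close>, and \<open>1 \<le> d / \<delta>\<close> for distinct
    \<open>x\<close> and \<open>z\<close>.\<close>
  define K where "K = A\<^sup>2 + 2 * A * B / \<delta>"
  have K: "0 \<le> K" using AB \<delta> by (simp add: K_def)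
  have close: "mdist M u v \<le> K * mdist M x z"
    if M: "u \<in> mspace M" "v \<in> mspace M" "x \<in> mspace M" "z \<in> mspace M" "x \<noteq> z"
      and le: "\<bar>f u - f v\<bar> \<le> \<bar>f x - f z\<bar>" for u v x z
  proof -
    have "1 / A * mdist M u v - B \<le> A * mdist M x z + B"
      using low[OF M(1,2)] up[OF M(3,4)] le by linarith
    then have "mdist M u v \<le> A\<^sup>2 * mdist M x z + 2 * A * B * 1"
      using AB by (simp add: field_simps power2_eq_square)
    also have "\<dots> \<le> A\<^sup>2 * mdist M x z + 2 * A * B * (mdist M x z / \<delta>)"
      using AB \<delta> M by (intro add_left_mono mult_left_mono) auto
    finally show ?thesis by (simp add: K_def algebra_simps)
  qed
  have "thin_order M T K"
    unfolding thin_order_def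
  proof (intro ballI impI)
    fix x y z
    assume M: "x \<in> mspace M" "y \<in> mspace M" "z \<in> mspace M" and ord: "(x, y) \<in> T" "(y, z) \<in> T"
    show "mdist M x y \<le> K * mdist M x z \<and> mdist M y z \<le> K * mdist M x z"
    proof (cases "x = z")
      case True
      then have "x = y" using ord T by (auto simp: order_on_defs dest: antisymD)
      then show ?thesis using True M by simp
    next
      case False
      have "f x \<le> f y" "f y \<le> f z" using ord by (auto simp: T_def)
      then show ?thesis using close M False by auto
    qed
  qed
  then show ?thesis
    using breakpoint_eq_2I[OF T ne K] by blast
qed

section \<open>Bounded spaces\<close>

lemma bounded_space_iff: "bounded_space M \<longleftrightarrow> (\<exists>B. \<forall>x\<in>mspace M. \<forall>y\<in>mspace M. mdist M x y \<le> B)"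
  by (simp add: bounded_space_def Metric_space.mbounded_alt[OF Metric_space_mspace_mdist])

text \<open>The additive constant absorbs the diameter. Thus bounded spaces fall under the same
  ordering argument as rays and lines.\<close>

lemma bounded_space_imp_embedding:
  assumes "bounded_space M"
  shows "quasi_isometric_embedding M line_space (\<lambda>_. 0)"
proof -
  obtain B where "\<And>x y. x \<in> mspace M \<Longrightarrow> y \<in> mspace M \<Longrightarrow> mdist M x y \<le> B"
    using assms by (auto simp: bounded_space_iff)
  then show ?thesis
    by (intro quasi_isometric_embeddingI[of _ _ _ 1 "max 0 B"])
      (auto simp: line_space_def le_max_iff_disj)
qed

lemma quasi_isometric_point_space_imp_bounded:
  assumes "quasi_isometric M point_space"
  shows "bounded_space M"
proof -
  obtain \<alpha> where emb: "quasi_isometric_embedding M point_space \<alpha>"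
    using assms by (auto simp: quasi_isometric_def quasi_isometry_def)
  then obtain A B where A: "1 \<le> A"
    and low: "\<And>x y. x \<in> mspace M \<Longrightarrow> y \<in> mspace M \<Longrightarrow>
      1 / A * mdist M x y - B \<le> mdist point_space (\<alpha> x) (\<alpha> y)"
    unfolding quasi_isometric_embedding_def by blast
  have \<alpha>: "\<alpha> \<in> mspace M \<rightarrow> {0}"
    using emb by (simp add: quasi_isometric_embedding_def point_space_def)
  have "mdist M x y \<le> A * B" if M: "x \<in> mspace M" "y \<in> mspace M" for x y
  proof -
    have "\<alpha> x = 0" "\<alpha> y = 0"
      using \<alpha> M by auto
    then show ?thesis
      using low[OF M] A by (simp add: point_space_def field_simps)
  qed
  then show ?thesis by (auto simp: bounded_space_iff)
qed

section \<open>Thin orders on coarsely geodesic spaces\<close>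

text \<open>A geodesic of \<open>N\<close> between the images is sampled at unit times, and each
  sample is replaced by a point of \<open>M\<close> whose image is close to it. Near-additivity is
  recorded for distances of images: there the error is additive, whereas in \<open>M\<close> it
  would pick up multiplicative constants.\<close>

lemma coarse_chains:
  fixes M :: "'a metric" and N :: "'b metric"
  assumes geo: "geodesic_space N" and qi: "quasi_isometric M N"
  obtains \<alpha> A B L D where "\<alpha> \<in> mspace M \<rightarrow> mspace N" "1 \<le> A" "0 \<le> B" "0 \<le> L" "0 \<le> D"
    and "\<And>x y. x \<in> mspace M \<Longrightarrow> y \<in> mspace M \<Longrightarrow> 1 / A * mdist M x y - B \<le> mdist N (\<alpha> x) (\<alpha> y)"
    and "\<And>x y. x \<in> mspace M \<Longrightarrow> y \<in> mspace M \<Longrightarrow> mdist N (\<alpha> x) (\<alpha> y) \<le> A * mdist M x y + B"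
    and "\<And>x y. x \<in> mspace M \<Longrightarrow> y \<in> mspace M \<Longrightarrow> \<exists>(p :: nat \<Rightarrow> 'a) n. p 0 = x \<and> p n = y \<and>
           range p \<subseteq> mspace M \<and> (\<forall>i<n. mdist M (p i) (p (Suc i)) \<le> L) \<and>
           (\<forall>i\<le>n. mdist N (\<alpha> x) (\<alpha> (p i)) + mdist N (\<alpha> (p i)) (\<alpha> y) \<le> mdist N (\<alpha> x) (\<alpha> y) + D)"
proof -
  obtain \<alpha> A B D where \<alpha>: "\<alpha> \<in> mspace M \<rightarrow> mspace N" and AB: "1 \<le> A" "0 \<le> B"
    and low: "\<And>x y. x \<in> mspace M \<Longrightarrow> y \<in> mspace M \<Longrightarrow> 1 / A * mdist M x y - B \<le> mdist N (\<alpha> x) (\<alpha> y)"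
    and up: "\<And>x y. x \<in> mspace M \<Longrightarrow> y \<in> mspace M \<Longrightarrow> mdist N (\<alpha> x) (\<alpha> y) \<le> A * mdist M x y + B"
    and dense: "\<And>w. w \<in> mspace N \<Longrightarrow> \<exists>x\<in>mspace M. mdist N w (\<alpha> x) \<le> D"
    using qi unfolding quasi_isometric_def quasi_isometry_def quasi_isometric_embedding_def by blast
  define E where "E = max 0 D"
  \<comment> \<open>Images of consecutive chain points are at most \<open>E + 1 + E\<close> apart;
    the lower embedding inequality then adds \<open>B\<close> and multiplies by
    \<open>A\<close>.\<close>
  define L where "L = A * (2 * E + 1 + B)"
  have E: "0 \<le> E" and L: "0 \<le> L" using AB by (auto simp: E_def L_def)
  have chain: "\<exists>(p :: nat \<Rightarrow> 'a) n. p 0 = x \<and> p n = y \<and>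
      range p \<subseteq> mspace M \<and> (\<forall>i<n. mdist M (p i) (p (Suc i)) \<le> L) \<and>
      (\<forall>i\<le>n. mdist N (\<alpha> x) (\<alpha> (p i)) + mdist N (\<alpha> (p i)) (\<alpha> y) \<le> mdist N (\<alpha> x) (\<alpha> y) + 2 * E)"
    if x: "x \<in> mspace M" and y: "y \<in> mspace M" for x y
  proof -
    define l where "l = mdist N (\<alpha> x) (\<alpha> y)"
    have \<alpha>xy: "\<alpha> x \<in> mspace N" "\<alpha> y \<in> mspace N" using \<alpha> x y by auto
    then obtain \<gamma> where \<gamma>: "\<gamma> \<in> {0..l} \<rightarrow> mspace N" "\<gamma> 0 = \<alpha> x" "\<gamma> l = \<alpha> y"
      and iso: "\<And>s t. s \<in> {0..l} \<Longrightarrow> t \<in> {0..l} \<Longrightarrow> mdist N (\<gamma> s) (\<gamma> t) = \<bar>s - t\<bar>"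
      using geo unfolding geodesic_space_def l_def by blast
    have l: "0 \<le> l" by (simp add: l_def)
    \<comment> \<open>Positivity of \<open>n\<close> matters when \<open>l = 0\<close>:
      \<open>x\<close> and \<open>y\<close> may differ although their images coincide, and the chain
      must still start at one and end at the other.\<close>
    obtain n :: nat where n: "l \<le> real n" "0 < n"
      using reals_Archimedean2[of l] l by (metis less_eq_real_def of_nat_0_less_iff order_le_less_trans)
    \<comment> \<open>Clipping keeps every sample time inside the geodesic, makes
      \<open>t n = l\<close>, and lets \<open>p\<close> be defined for all indices.\<close>
    define t where "t i = min l (real i)" for i
    have t: "t i \<in> {0..l}" for i using l by (auto simp: t_def)
    have "\<exists>q\<in>mspace M. mdist N (\<gamma> (t i)) (\<alpha> q) \<le> E \<and> (i = 0 \<longrightarrow> q = x) \<and> (i = n \<longrightarrow> q = y)" for i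
    proof -
      have \<gamma>t: "\<gamma> (t i) \<in> mspace N" using \<gamma>(1) t by blast
      consider "i = 0" | "i \<noteq> 0" "i = n" | "i \<noteq> 0" "i \<noteq> n" by blast
      then show ?thesis
      proof cases
        case 1
        then have "\<gamma> (t i) = \<alpha> x" using \<gamma> l by (simp add: t_def)
        then show ?thesis using 1 x \<alpha>xy E n by auto
      next
        case 2
        then have "\<gamma> (t i) = \<alpha> y" using \<gamma> n by (simp add: t_def)
        then show ?thesis using 2 y \<alpha>xy E by auto
      next
        case 3
        then show ?thesis using dense[OF \<gamma>t] by (force simp: E_def)
      qed
    qed
    then obtain p where p: "\<And>i. p i \<in> mspace M" "\<And>i. mdist N (\<gamma> (t i)) (\<alpha> (p i)) \<le> E"
      "p 0 = x" "p n = y"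
      by metis
    have near: "mdist N (\<alpha> (p i)) (\<alpha> (p j)) \<le> 2 * E + \<bar>t i - t j\<bar>"
        "\<bar>mdist N w (\<alpha> (p i)) - mdist N w (\<gamma> (t i))\<bar> \<le> E"
      if "w \<in> mspace N" for i j w
    proof -
      have in_N: "\<alpha> (p k) \<in> mspace N" "\<gamma> (t k) \<in> mspace N" for k
        using p(1)[of k] \<alpha> \<gamma>(1) t by blast+
      show "mdist N (\<alpha> (p i)) (\<alpha> (p j)) \<le> 2 * E + \<bar>t i - t j\<bar>"
        using mdist_triangle[of "\<alpha> (p i)" N "\<gamma> (t i)" "\<alpha> (p j)"]
          mdist_triangle[of "\<gamma> (t i)" N "\<gamma> (t j)" "\<alpha> (p j)"]
          p(2)[of i] p(2)[of j] iso[OF t t, of i j] in_N by (simp add: mdist_commute)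
      show "\<bar>mdist N w (\<alpha> (p i)) - mdist N w (\<gamma> (t i))\<bar> \<le> E"
        using mdist_triangle[of w N "\<gamma> (t i)" "\<alpha> (p i)"] mdist_triangle[of w N "\<alpha> (p i)" "\<gamma> (t i)"]
          p(2)[of i] in_N that by (simp add: mdist_commute)
    qed
    have "mdist M (p i) (p (Suc i)) \<le> L" for i
    proof -
      have "\<bar>t i - t (Suc i)\<bar> \<le> 1" by (auto simp: t_def)
      then have "1 / A * mdist M (p i) (p (Suc i)) - B \<le> 2 * E + 1"
        using low[OF p(1) p(1), of i "Suc i"] near(1)[OF \<alpha>xy(1), of i "Suc i"] by linarith
      then show ?thesis using AB by (simp add: L_def field_simps)
    qed
    \<comment> \<open>On the geodesic the two distances add up exactly to \<open>l\<close>; moving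
      to the chain point costs \<open>E\<close> for each.\<close>
    moreover have "mdist N (\<alpha> x) (\<alpha> (p i)) + mdist N (\<alpha> (p i)) (\<alpha> y) \<le> l + 2 * E" for i
    proof -
      have "mdist N (\<alpha> x) (\<gamma> (t i)) = t i" "mdist N (\<alpha> y) (\<gamma> (t i)) = l - t i"
        using iso[OF _ t, of 0 i] iso[OF _ t, of l i] \<gamma> t[of i] l by auto
      then show ?thesis
        using near(2)[OF \<alpha>xy(1), of i] near(2)[OF \<alpha>xy(2), of i]
          mdist_commute[of N "\<alpha> (p i)" "\<alpha> y"] by linarith
    qed
    ultimately show ?thesis
      using p unfolding l_def by (intro exI[of _ p] exI[of _ n]) auto
  qed
  show ?thesis
    using that[OF \<alpha> AB L _ low up chain] E by auto
qed

text \<open>Look at the first chain point not below \<open>z\<close>. Either it is the start, which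
  then equals \<open>z\<close>, or \<open>z\<close> lies in the order between two consecutive chain
  points, and thinness bounds its distance to the later one by \<open>K\<close> times the
  step.\<close>

lemma coarse_chain_meets_interval:
  fixes p :: "nat \<Rightarrow> 'a"
  assumes T: "linear_order_on (mspace M) T" and thin: "thin_order M T K" and K: "1 \<le> K" and L: "0 \<le> L"
    and p: "range p \<subseteq> mspace M" "\<And>i. i < n \<Longrightarrow> mdist M (p i) (p (Suc i)) \<le> L"
    and z: "z \<in> mspace M" "(p 0, z) \<in> T" "(z, p n) \<in> T"
  shows "\<exists>i\<le>n. mdist M z (p i) \<le> K * L"
proof -
  define i where "i = (LEAST i. (z, p i) \<in> T)"
  have i: "(z, p i) \<in> T" "i \<le> n" and below: "\<And>j. j < i \<Longrightarrow> (z, p j) \<notin> T"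
    using z(3) unfolding i_def by (auto intro: LeastI Least_le dest: not_less_Least)
  have pM: "p j \<in> mspace M" for j using p(1) by auto
  show ?thesis
  proof (cases i)
    case 0
    then have "z = p 0"
      using i(1) z(2) T by (auto simp: order_on_defs dest: antisymD)
    then show ?thesis
      using K L z by (intro exI[of _ 0]) auto
  next
    case (Suc j)
    have "(z, p j) \<notin> T" using below Suc by simp
    then have "(p j, z) \<in> T"
      using T z(1) pM[of j] unfolding order_on_defs refl_on_def total_on_def by metis
    then have "mdist M z (p i) \<le> K * mdist M (p j) (p i)"
      using thin z(1) pM i(1) unfolding thin_order_def by blast
    also have "\<dots> \<le> K * L"
      using p(2)[of j] i(2) Suc K by (intro mult_left_mono) auto
    finally show ?thesis using i(2) by blast
  qed
qed

lemma discrete_intermediate_value: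
  fixes a :: "nat \<Rightarrow> real"
  assumes step: "\<And>i. i < n \<Longrightarrow> \<bar>a (Suc i) - a i\<bar> \<le> S" and "0 \<le> S" and "a 0 \<le> r" "r \<le> a n"
  shows "\<exists>i\<le>n. \<bar>a i - r\<bar> \<le> S"
proof -
  define i where "i = (LEAST i. r \<le> a i)"
  have i: "r \<le> a i" "i \<le> n" and below: "\<And>j. j < i \<Longrightarrow> a j < r"
    using assms(4) unfolding i_def by (auto intro: LeastI Least_le dest: not_less_Least)
  have "\<bar>a i - r\<bar> \<le> S"
  proof (cases i)
    case 0
    then show ?thesis using i assms by auto
  next
    case (Suc j)
    then show ?thesis using below[of j] step[of j] i by auto
  qed
  then show ?thesis using i by blast
qed

text \<open>The coordinate is the distance to a base point, measured in \<open>N\<close> and signed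
  by the order. The second conclusion says that the image is coarsely connected and comes near 0: a
  chain from the base point to \<open>y\<close> moves its coordinate by bounded steps.\<close>

lemma thin_order_coordinate:
  fixes M :: "'a metric" and N :: "'b metric"
  assumes ne: "mspace M \<noteq> {}" and geo: "geodesic_space N" and qi: "quasi_isometric M N"
    and T: "linear_order_on (mspace M) T" and K: "1 \<le> K" and thin: "thin_order M T K"
  obtains f S where "quasi_isometric_embedding M line_space f"
    and "\<And>y r. y \<in> mspace M \<Longrightarrow> 0 \<le> r \<and> r \<le> f y \<or> f y \<le> r \<and> r \<le> 0 \<Longrightarrow> \<exists>x\<in>mspace M. \<bar>f x - r\<bar> \<le> S"
proof -
  obtain \<alpha> A B L D where \<alpha>: "\<alpha> \<in> mspace M \<rightarrow> mspace N" and nonneg: "1 \<le> A" "0 \<le> B" "0 \<le> L" "0 \<le> D"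
    and low: "\<And>x y. x \<in> mspace M \<Longrightarrow> y \<in> mspace M \<Longrightarrow> 1 / A * mdist M x y - B \<le> mdist N (\<alpha> x) (\<alpha> y)"
    and up: "\<And>x y. x \<in> mspace M \<Longrightarrow> y \<in> mspace M \<Longrightarrow> mdist N (\<alpha> x) (\<alpha> y) \<le> A * mdist M x y + B"
    and chain: "\<And>x y. x \<in> mspace M \<Longrightarrow> y \<in> mspace M \<Longrightarrow> \<exists>(p :: nat \<Rightarrow> 'a) n. p 0 = x \<and> p n = y \<and>
           range p \<subseteq> mspace M \<and> (\<forall>i<n. mdist M (p i) (p (Suc i)) \<le> L) \<and>
           (\<forall>i\<le>n. mdist N (\<alpha> x) (\<alpha> (p i)) + mdist N (\<alpha> (p i)) (\<alpha> y) \<le> mdist N (\<alpha> x) (\<alpha> y) + D)"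
    using coarse_chains[OF geo qi] by metis
  define e where "e x y = mdist N (\<alpha> x) (\<alpha> y)" for x y
  have e_sym: "e x y = e y x" and e_nonneg: "0 \<le> e x y" for x y
    by (simp_all add: e_def mdist_commute)
  have e_tri: "e x z \<le> e x y + e y z" if "x \<in> mspace M" "y \<in> mspace M" "z \<in> mspace M" for x y z
    unfolding e_def using \<alpha> that by (intro mdist_triangle) auto
  \<comment> \<open>The chain from \<open>x\<close> to \<open>y\<close> passes within
    \<open>K * L\<close> of an intermediate \<open>z\<close>, hence within \<open>Q\<close> for
    \<open>e\<close>. Replacing the chain point by \<open>z\<close> costs \<open>Q\<close> on either
    side, which gives \<open>R\<close>.\<close>
  define Q where "Q = A * (K * L) + B"
  define R where "R = D + 2 * Q"
  have R: "0 \<le> R" using nonneg K by (simp add: R_def Q_def)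
  have add: "e x z + e z y \<le> e x y + R"
    if M: "x \<in> mspace M" "z \<in> mspace M" "y \<in> mspace M" and ord: "(x, z) \<in> T" "(z, y) \<in> T" for x y z
  proof -
    obtain p :: "nat \<Rightarrow> 'a" and n where p: "p 0 = x" "p n = y" "range p \<subseteq> mspace M"
      "\<And>i. i < n \<Longrightarrow> mdist M (p i) (p (Suc i)) \<le> L"
      and pe: "\<And>i. i \<le> n \<Longrightarrow> e x (p i) + e (p i) y \<le> e x y + D"
      using chain[OF M(1,3)] unfolding e_def by blast
    obtain i where i: "i \<le> n" "mdist M z (p i) \<le> K * L"
      using coarse_chain_meets_interval[OF T thin K nonneg(3) p(3,4) M(2)] ord p(1,2) by auto
    have piM: "p i \<in> mspace M" using p(3) by auto
    have "A * mdist M z (p i) \<le> A * (K * L)"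
      using i(2) nonneg by (intro mult_left_mono) auto
    then have "e z (p i) \<le> Q"
      using up[OF M(2) piM] by (simp add: e_def Q_def)
    then show ?thesis
      using pe[OF i(1)] e_tri[OF M(1) piM M(2)] e_tri[OF M(2) piM M(3)] e_sym[of "p i" z]
      unfolding R_def by linarith
  qed
  obtain b where b: "b \<in> mspace M" using ne by blast
  define f where "f x = (if (b, x) \<in> T then e b x else - e b x)" for x
  have tot: "(x, y) \<in> T \<or> (y, x) \<in> T" if "x \<in> mspace M" "y \<in> mspace M" for x y
    using T that unfolding order_on_defs refl_on_def total_on_def by metis
  \<comment> \<open>According to the position of \<open>b\<close>, near-additivity is applied to
    \<open>b, x, y\<close>, to \<open>x, b, y\<close> or to \<open>x, y, b\<close>. Transitivity
    excludes the fourth combination of signs.\<close>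
  have ordered: "\<bar>f y - f x - e x y\<bar> \<le> R"
    if M: "x \<in> mspace M" "y \<in> mspace M" and ord: "(x, y) \<in> T" for x y
  proof -
    have tr: "(u, w) \<in> T" if "(u, v) \<in> T" "(v, w) \<in> T" for u v w
      using T that by (auto simp: order_on_defs dest: transD)
    consider "(b, x) \<in> T" "(b, y) \<in> T" | "(b, x) \<notin> T" "(b, y) \<in> T" | "(b, x) \<notin> T" "(b, y) \<notin> T"
      using tr ord by blast
    then show ?thesis
    proof cases
      case 1
      then show ?thesis
        using add[OF b M 1(1) ord] e_tri[OF b M] R by (simp add: f_def)
    next
      case 2
      then have "(x, b) \<in> T" using tot b M by blast
      then show ?thesis
        using add[OF M(1) b M(2) _ 2(2)] e_tri[OF M(1) b M(2)] R 2 e_sym[of x b] by (simp add: f_def)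
    next
      case 3
      then have "(y, b) \<in> T" using tot b M by blast
      then show ?thesis
        using add[OF M b ord] e_tri[OF M b] R 3 e_sym[of x b] e_sym[of y b] by (simp add: f_def)
    qed
  qed
  have coarse: "\<bar>\<bar>f x - f y\<bar> - e x y\<bar> \<le> R" if M: "x \<in> mspace M" "y \<in> mspace M" for x y
    using tot[OF M] ordered[OF M] ordered[OF M(2,1)] e_nonneg[of x y] e_sym[of x y] by auto
  have emb: "quasi_isometric_embedding M line_space f"
  proof (rule quasi_isometric_embeddingI[of _ _ _ A "B + R"])
    fix x y assume M: "x \<in> mspace M" "y \<in> mspace M"
    show "1 / A * mdist M x y - (B + R) \<le> mdist line_space (f x) (f y)"
      "mdist line_space (f x) (f y) \<le> A * mdist M x y + (B + R)"
      using coarse[OF M] low[OF M] up[OF M] by (auto simp: e_def line_space_def dist_real_def)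
  qed (use nonneg R in \<open>auto simp: line_space_def\<close>)
  \<comment> \<open>A chain step changes \<open>e\<close> by at most \<open>A * L + B\<close>;
    passing from \<open>e\<close> to differences of \<open>f\<close> costs another
    \<open>R\<close>.\<close>
  define S where "S = A * L + B + R"
  have S: "0 \<le> S" using nonneg R by (simp add: S_def)
  have "\<exists>x\<in>mspace M. \<bar>f x - r\<bar> \<le> S"
    if y: "y \<in> mspace M" and r: "0 \<le> r \<and> r \<le> f y \<or> f y \<le> r \<and> r \<le> 0" for y r
  proof -
    obtain p :: "nat \<Rightarrow> 'a" and n where p: "p 0 = b" "p n = y" "range p \<subseteq> mspace M"
      and pL: "\<And>i. i < n \<Longrightarrow> mdist M (p i) (p (Suc i)) \<le> L"
      using chain[OF b y] by blast
    have pM: "p i \<in> mspace M" for i using p(3) by auto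
    have step: "\<bar>f (p (Suc i)) - f (p i)\<bar> \<le> S" if "i < n" for i
    proof -
      have "A * mdist M (p i) (p (Suc i)) \<le> A * L"
        using pL[OF that] nonneg by (intro mult_left_mono) auto
      then show ?thesis
        using coarse[OF pM pM, of i "Suc i"] up[OF pM pM, of i "Suc i"] by (auto simp: e_def S_def)
    qed
    have "\<alpha> b \<in> mspace N" using \<alpha> b by auto
    then have "e b b = 0" by (simp add: e_def)
    then have f0: "f (p 0) = 0" using p by (simp add: f_def)
    have "\<exists>i\<le>n. \<bar>f (p i) - r\<bar> \<le> S"
    proof (cases "0 \<le> r \<and> r \<le> f y")
      case True
      then show ?thesis
        using discrete_intermediate_value[of n "\<lambda>i. f (p i)" S r] step S f0 p(2) by auto
    next
      case False
      \<comment> \<open>On the negative side the intermediate value argument is run for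
        \<open>- f\<close> and \<open>- r\<close>.\<close>
      then have "\<exists>i\<le>n. \<bar>- f (p i) - (- r)\<bar> \<le> S"
        using discrete_intermediate_value[of n "\<lambda>i. - f (p i)" S "- r"] step S f0 p(2) r
        by (auto simp: abs_minus_commute)
      then show ?thesis by (simp add: abs_minus_commute)
    qed
    then show ?thesis using pM by blast
  qed
  then show ?thesis using that emb by blast
qed

section \<open>Coarse intervals in the line\<close>

lemma quasi_isometric_ray_spaceI:
  assumes emb: "quasi_isometric_embedding M line_space f"
    and below: "\<And>x. x \<in> mspace M \<Longrightarrow> - c \<le> f x"
    and dense: "\<And>r. 0 \<le> r \<Longrightarrow> \<exists>x\<in>mspace M. \<bar>f x - r\<bar> \<le> S"
  shows "quasi_isometric M ray_space"
proof -
  obtain A B where AB: "1 \<le> A" "0 \<le> B"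
    and low: "\<And>x y. x \<in> mspace M \<Longrightarrow> y \<in> mspace M \<Longrightarrow> 1 / A * mdist M x y - B \<le> \<bar>f x - f y\<bar>"
    and up: "\<And>x y. x \<in> mspace M \<Longrightarrow> y \<in> mspace M \<Longrightarrow> \<bar>f x - f y\<bar> \<le> A * mdist M x y + B"
    using emb by (auto simp: quasi_isometric_embedding_def line_space_def dist_real_def)
  \<comment> \<open>Values of \<open>f\<close> may lie slightly below 0. Clamping moves each by at
    most \<open>C\<close>, so distances change by at most \<open>2 * C\<close>, and it never
    increases the distance to a point of the ray.\<close>
  define g where "g x = max 0 (f x)" for x
  define C where "C = max 0 c"
  have close: "\<bar>g x - f x\<bar> \<le> C" if "x \<in> mspace M" for x
    using below[OF that] by (auto simp: g_def C_def)
  have "quasi_isometric_embedding M ray_space g"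
  proof (rule quasi_isometric_embeddingI[of _ _ _ A "B + 2 * C"])
    fix x y assume M: "x \<in> mspace M" "y \<in> mspace M"
    show "1 / A * mdist M x y - (B + 2 * C) \<le> mdist ray_space (g x) (g y)"
      "mdist ray_space (g x) (g y) \<le> A * mdist M x y + (B + 2 * C)"
      using low[OF M] up[OF M] close[OF M(1)] close[OF M(2)]
      by (auto simp: ray_space_def dist_real_def)
  qed (use AB in \<open>auto simp: ray_space_def g_def C_def\<close>)
  moreover have "\<exists>x\<in>mspace M. mdist ray_space r (g x) \<le> S" if "r \<in> mspace ray_space" for r
  proof -
    have "0 \<le> r" using that by (simp add: ray_space_def)
    then obtain x where "x \<in> mspace M" "\<bar>f x - r\<bar> \<le> S" using dense by blast
    then show ?thesis
      using \<open>0 \<le> r\<close> by (intro bexI[of _ x]) (auto simp: ray_space_def dist_real_def g_def)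
  qed
  ultimately show ?thesis
    unfolding quasi_isometric_def quasi_isometry_def by blast
qed

lemma quasi_isometric_embedding_uminus:
  assumes "quasi_isometric_embedding M line_space f"
  shows "quasi_isometric_embedding M line_space (\<lambda>x. - f x)"
  using assms by (auto simp: quasi_isometric_embedding_def line_space_def dist_minus)

lemma bounded_space_imp_quasi_isometric_point:
  assumes "mspace M \<noteq> {}" "bounded_space M"
  shows "quasi_isometric M point_space"
  unfolding quasi_isometric_def quasi_isometry_def
proof (intro exI[of _ "\<lambda>_. 0"] conjI exI[of _ 0])
  show "quasi_isometric_embedding M point_space (\<lambda>_. 0)"
    using bounded_space_imp_embedding[OF assms(2)]
    by (simp add: quasi_isometric_embedding_def point_space_def line_space_def)
qed (use assms in \<open>auto simp: point_space_def\<close>)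

text \<open>The density hypothesis makes the image coarsely an interval around or ending at 0, so
  the type of \<open>M\<close> depends only on which sides of the image are unbounded.\<close>

lemma coarsely_connected_subset_of_line:
  assumes ne: "mspace M \<noteq> {}" and emb: "quasi_isometric_embedding M line_space f"
    and dense: "\<And>y r. y \<in> mspace M \<Longrightarrow> 0 \<le> r \<and> r \<le> f y \<or> f y \<le> r \<and> r \<le> 0 \<Longrightarrow>
      \<exists>x\<in>mspace M. \<bar>f x - r\<bar> \<le> S"
  shows "quasi_isometric M point_space \<or> quasi_isometric M ray_space \<or> quasi_isometric M line_space"
proof -
  \<comment> \<open>Unboundedness supplies an image point beyond \<open>r\<close>, so
    \<open>r\<close> lies between 0 and that point.\<close>
  have pos: "\<exists>x\<in>mspace M. \<bar>f x - r\<bar> \<le> S" if "\<And>c. \<exists>y\<in>mspace M. c < f y" "0 \<le> r" for r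
    using that(1)[of r] that(2) dense[of _ r] by auto
  have neg: "\<exists>x\<in>mspace M. \<bar>f x - r\<bar> \<le> S" if "\<And>c. \<exists>y\<in>mspace M. f y < c" "r \<le> 0" for r
    using that(1)[of r] that(2) dense[of _ r] by auto
  consider (point) c c' where "\<And>x. x \<in> mspace M \<Longrightarrow> c \<le> f x" "\<And>x. x \<in> mspace M \<Longrightarrow> f x \<le> c'"
    | (right) c where "\<And>x. x \<in> mspace M \<Longrightarrow> c \<le> f x" "\<And>c. \<exists>y\<in>mspace M. c < f y"
    | (left) c where "\<And>x. x \<in> mspace M \<Longrightarrow> f x \<le> c" "\<And>c. \<exists>y\<in>mspace M. f y < c"
    | (line) "\<And>c. \<exists>y\<in>mspace M. c < f y" "\<And>c. \<exists>y\<in>mspace M. f y < c"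
  proof (cases "\<exists>c. \<forall>x\<in>mspace M. c \<le> f x"; cases "\<exists>c. \<forall>x\<in>mspace M. f x \<le> c")
    assume "\<exists>c. \<forall>x\<in>mspace M. c \<le> f x" "\<exists>c. \<forall>x\<in>mspace M. f x \<le> c"
    then show thesis using point by blast
  next
    assume "\<exists>c. \<forall>x\<in>mspace M. c \<le> f x" "\<not> (\<exists>c. \<forall>x\<in>mspace M. f x \<le> c)"
    then show thesis using right by (force simp: not_le)
  next
    assume "\<not> (\<exists>c. \<forall>x\<in>mspace M. c \<le> f x)" "\<exists>c. \<forall>x\<in>mspace M. f x \<le> c"
    then show thesis using left by (force simp: not_le)
  next
    assume "\<not> (\<exists>c. \<forall>x\<in>mspace M. c \<le> f x)" "\<not> (\<exists>c. \<forall>x\<in>mspace M. f x \<le> c)"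
    then show thesis using line by (force simp: not_le)
  qed
  then show ?thesis
  proof cases
    case point
    obtain A B where A: "1 \<le> A"
      and low: "\<And>x y. x \<in> mspace M \<Longrightarrow> y \<in> mspace M \<Longrightarrow> 1 / A * mdist M x y - B \<le> \<bar>f x - f y\<bar>"
      using emb by (auto simp: quasi_isometric_embedding_def line_space_def dist_real_def)
    have "mdist M x y \<le> A * (c' - c + B)" if M: "x \<in> mspace M" "y \<in> mspace M" for x y
    proof -
      have "1 / A * mdist M x y \<le> c' - c + B"
        using low[OF M] point(1)[OF M(1)] point(1)[OF M(2)] point(2)[OF M(1)] point(2)[OF M(2)]
        by linarith
      then show ?thesis using A by (simp add: field_simps)
    qed
    then have "bounded_space M" by (auto simp: bounded_space_iff)
    then show ?thesis using bounded_space_imp_quasi_isometric_point[OF ne] by blast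
  next
    case right
    have "quasi_isometric M ray_space"
      using right(1) pos[OF right(2)] by (intro quasi_isometric_ray_spaceI[OF emb, of "- c" S]) auto
    then show ?thesis by blast
  next
    case left
    \<comment> \<open>Reflection at 0 reduces this case to the previous one.\<close>
    have "\<exists>x\<in>mspace M. \<bar>- f x - r\<bar> \<le> S" if "0 \<le> r" for r
      using neg[OF left(2), of "- r"] that by (simp add: abs_minus_commute add.commute)
    then have "quasi_isometric M ray_space"
      using left(1)
      by (intro quasi_isometric_ray_spaceI[OF quasi_isometric_embedding_uminus[OF emb], of c S]) auto
    then show ?thesis by blast
  next
    case line
    have "\<exists>x\<in>mspace M. mdist line_space r (f x) \<le> S" for r
      using pos[OF line(1), of r] neg[OF line(2), of r]
      by (cases "0 \<le> r") (auto simp: line_space_def dist_real_def abs_minus_commute)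
    then show ?thesis
      using emb unfolding quasi_isometric_def quasi_isometry_def by blast
  qed
qed

section \<open>Both claims on the breakpoint\<close>

theorem lemma4p1:
  fixes M :: "'a metric" and N :: "'b metric"
  assumes "mspace M \<noteq> {}"
    and "geodesic_space N" and "quasi_isometric M N"
  shows "(\<not> quasi_isometric M point_space \<and> \<not> quasi_isometric M ray_space \<and>
            \<not> quasi_isometric M line_space \<longrightarrow> breakpoint M \<ge> 3) \<and>
         (uniformly_discrete M \<longrightarrow>
            (breakpoint M = 2 \<longleftrightarrow>
               bounded_space M \<or> quasi_isometric M ray_space \<or> quasi_isometric M line_space))"
proof -
  \<comment> \<open>The contrapositive of the first claim; it also gives one direction of the
    second, where being quasi-isometric to a point is weakened to boundedness.\<close>
  have a: "quasi_isometric M point_space \<or> quasi_isometric M ray_space \<or> quasi_isometric M line_space"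
    if small: "\<not> breakpoint M \<ge> 3"
  proof -
    obtain T K where T: "linear_order_on (mspace M) T" and K: "1 \<le> K" and thin: "thin_order M T K"
      using breakpoint_less_3E[OF assms(1) small] by blast
    obtain f S where "quasi_isometric_embedding M line_space f"
      "\<And>y r. y \<in> mspace M \<Longrightarrow> 0 \<le> r \<and> r \<le> f y \<or> f y \<le> r \<and> r \<le> 0 \<Longrightarrow> \<exists>x\<in>mspace M. \<bar>f x - r\<bar> \<le> S"
      using thin_order_coordinate[OF assms T K thin] by metis
    then show ?thesis
      by (rule coarsely_connected_subset_of_line[OF assms(1)])
  qed
  have "breakpoint M = 2 \<longleftrightarrow>
      bounded_space M \<or> quasi_isometric M ray_space \<or> quasi_isometric M line_space"
    if ud: "uniformly_discrete M"
  proof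
    assume "breakpoint M = 2"
    then have "\<not> breakpoint M \<ge> 3" by simp
    then show "bounded_space M \<or> quasi_isometric M ray_space \<or> quasi_isometric M line_space"
      using a quasi_isometric_point_space_imp_bounded by blast
  next
    assume "bounded_space M \<or> quasi_isometric M ray_space \<or> quasi_isometric M line_space"
    \<comment> \<open>The ray carries the distance of the line, so all three alternatives yield an
      embedding into the line.\<close>
    moreover have "quasi_isometric_embedding M line_space \<alpha>"
      if "quasi_isometric_embedding M ray_space \<alpha>" for \<alpha>
      using that by (simp add: quasi_isometric_embedding_def ray_space_def line_space_def)
    ultimately have "\<exists>f. quasi_isometric_embedding M line_space f"
      using bounded_space_imp_embedding unfolding quasi_isometric_def quasi_isometry_def by blast
    then show "breakpoint M = 2"
      using uniformly_discrete_embedding_imp_breakpoint[OF assms(1) ud] by blast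
  qed
  with a show ?thesis by blast
qed

end
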